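(* Let $0<k<m$ be integers and let $(\mathcal T^{(n)})_{n=1,\dots,N}$ be a family of $N$ regular meshes made of simplexes, with mesh sizes $h_1,\dots,h_N>0$. Assume $N=N_1+N_2$, where $N_1$ is the number of meshes with $h_n\le h^*$ and $N_2$ the number of meshes with $h_n>h^*$, the meshes being indexed so that $h_n\le h^*$ for $1\le n\le N_1$ and $h_n>h^*$ for $N_1+1\le n\le N$. Let $S_N=\sum_{n=1}^N Y_n$, where $Y_1,\dots,Y_N$ are independent and $Y_n$ is the indicator of the event $\{X^{(m)}(h_n)\le X^{(k)}(h_n)\}$. Then $$\mathrm{Prob}\{S_N\ge1\}=1-\frac1{2^{N_1}}\left[\frac{h_1\cdots h_{N_1}}{(h^* )^{N_1}}\right]^{m-k}\ \prod_{n=N_1+1}^{N}\left[1-\frac12\left(\frac{h^*}{h_n}\right)^{m-k}\right],$$ with empty products equal to $1$.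
   Context: Let $u$ be the exact solution of an elliptic variational problem ($a(u,v)=l(v)$ for all $v\in V$, with $V$ a Hilbert Sobolev space on a bounded open set $\Omega$, $a$ bilinear, continuous and $V$-elliptic, $l$ linear and continuous), with $u\in H^{m+1}(\Omega)$. For $i\in\{k,m\}$, $u^{(i)}_{h}$ denotes the $P_i$ Lagrange finite element approximation of $u$ on a regular simplicial mesh of $\Omega$ of mesh size $h$ (largest diameter of its simplexes), and $C_i>0$ is a constant independent of $h$ with $\|u^{(i)}_h-u\|_{1,\Omega}\le C_ih^i$, where $\|\cdot\|_{1,\Omega}$ is the $H^1(\Omega)$ norm. Probabilistic model: the error $X^{(i)}(h):=\|u^{(i)}_h-u\|_{1,\Omega}$ is treated as a random variable (randomness coming from the mesh generation). It is assumed that, for each mesh size $h$ considered, $X^{(k)}(h)$ and $X^{(m)}(h)$ are independent and that $X^{(i)}(h)$ is uniformly distributed on $[0,C_ih^i]$ for $i\in\{k,m\}$. Set $h^*:=(C_k/C_m)^{1/(m-k)}$ and $\mathcal P(h):=\mathrm{Prob}\{X^{(m)}(h)\le X^{(k)}(h)\}$; under these assumptions $\mathcal P(h)=1-\frac12(h/h^* )^{m-k}$ for $0<h\le h^*$ and $\mathcal P(h)=\frac12(h^*/h)^{m-k}$ for $h\ge h^*$. $Y_n=1$ if $X^{(m)}(h_n)\le X^{(k)}(h_n)$ and $Y_n=0$ otherwise; the Bernoulli variables $Y_n$ are assumed to be independent. *)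

theory Defs
  imports "HOL-Probability.Probability"
begin

(* Sobolev spaces on \<Omega>. Elements are representatives, i.e. total functions 'a \<Rightarrow> real of
   which only the values on \<Omega> (up to null sets) matter. *)

fun C_diff :: "nat \<Rightarrow> ('a::euclidean_space \<Rightarrow> real) \<Rightarrow> bool" where
  "C_diff 0 f \<longleftrightarrow> continuous_on UNIV f"
| "C_diff (Suc j) f \<longleftrightarrow> (\<forall>x. f differentiable (at x)) \<and>
     (\<forall>b\<in>Basis. C_diff j (\<lambda>x. frechet_derivative f (at x) b))"

definition test_functions :: "'a::euclidean_space set \<Rightarrow> ('a \<Rightarrow> real) set" where
  "test_functions \<Omega> =
     {\<phi>. (\<forall>j. C_diff j \<phi>) \<and> (\<exists>K. compact K \<and> K \<subseteq> \<Omega> \<and> (\<forall>x. x \<notin> K \<longrightarrow> \<phi> x = 0))}"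

definition L2 :: "'a::euclidean_space set \<Rightarrow> ('a \<Rightarrow> real) set" where
  "L2 \<Omega> = {f. f \<in> borel_measurable (lebesgue_on \<Omega>) \<and>
              integrable (lebesgue_on \<Omega>) (\<lambda>x. (f x)\<^sup>2)}"

definition has_weak_partial ::
    "'a::euclidean_space set \<Rightarrow> 'a \<Rightarrow> ('a \<Rightarrow> real) \<Rightarrow> ('a \<Rightarrow> real) \<Rightarrow> bool" where
  "has_weak_partial \<Omega> b f g \<longleftrightarrow>
     (\<forall>\<phi>\<in>test_functions \<Omega>.
        (LINT x|lebesgue_on \<Omega>. f x * frechet_derivative \<phi> (at x) b)
          = - (LINT x|lebesgue_on \<Omega>. g x * \<phi> x))"

(* H^s(\<Omega>): all weak derivatives of order at most s exist and lie in L2. *)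
fun sobolev :: "'a::euclidean_space set \<Rightarrow> nat \<Rightarrow> ('a \<Rightarrow> real) set" where
  "sobolev \<Omega> 0 = L2 \<Omega>"
| "sobolev \<Omega> (Suc s) =
     {f \<in> L2 \<Omega>. \<forall>b\<in>Basis. \<exists>g\<in>sobolev \<Omega> s. has_weak_partial \<Omega> b f g}"

(* Unique up to null sets of \<Omega> when it exists, so integrals do not depend on the choice. *)
definition weak_partial ::
    "'a::euclidean_space set \<Rightarrow> 'a \<Rightarrow> ('a \<Rightarrow> real) \<Rightarrow> 'a \<Rightarrow> real" where
  "weak_partial \<Omega> b f = (SOME g. g \<in> L2 \<Omega> \<and> has_weak_partial \<Omega> b f g)"

definition H1_norm :: "'a::euclidean_space set \<Rightarrow> ('a \<Rightarrow> real) \<Rightarrow> real" where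
  "H1_norm \<Omega> f =
     sqrt ((LINT x|lebesgue_on \<Omega>. (f x)\<^sup>2)
           + (\<Sum>b\<in>Basis. LINT x|lebesgue_on \<Omega>. (weak_partial \<Omega> b f x)\<^sup>2))"

(* A Hilbert space V of H^1 functions with the H^1 norm, e.g. H^1 itself or the closure of the
   test functions. Sequential closedness also makes V stable under changing representatives
   on null sets. *)
definition closed_H1_subspace :: "'a::euclidean_space set \<Rightarrow> ('a \<Rightarrow> real) set \<Rightarrow> bool" where
  "closed_H1_subspace \<Omega> V \<longleftrightarrow>
     V \<subseteq> sobolev \<Omega> 1 \<and> (\<lambda>x. 0) \<in> V \<and>
     (\<forall>f\<in>V. \<forall>g\<in>V. \<forall>c d. (\<lambda>x. c * f x + d * g x) \<in> V) \<and>
     (\<forall>F f. (\<forall>j::nat. F j \<in> V) \<and> f \<in> sobolev \<Omega> 1 \<and>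
        (\<lambda>j. H1_norm \<Omega> (\<lambda>x. F j x - f x)) \<longlonglongrightarrow> 0 \<longrightarrow> f \<in> V)"

definition linear_form_on ::
    "('a \<Rightarrow> real) set \<Rightarrow> (('a \<Rightarrow> real) \<Rightarrow> real) \<Rightarrow> bool" where
  "linear_form_on V l \<longleftrightarrow>
     (\<forall>f\<in>V. \<forall>g\<in>V. \<forall>c d. l (\<lambda>x. c * f x + d * g x) = c * l f + d * l g)"

definition elliptic_problem ::
    "'a::euclidean_space set \<Rightarrow> ('a \<Rightarrow> real) set \<Rightarrow> (('a \<Rightarrow> real) \<Rightarrow> ('a \<Rightarrow> real) \<Rightarrow> real)
      \<Rightarrow> (('a \<Rightarrow> real) \<Rightarrow> real) \<Rightarrow> bool" where
  "elliptic_problem \<Omega> V a l \<longleftrightarrow>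
     open \<Omega> \<and> bounded \<Omega> \<and> closed_H1_subspace \<Omega> V \<and>
     (\<forall>f\<in>V. linear_form_on V (a f)) \<and> (\<forall>g\<in>V. linear_form_on V (\<lambda>f. a f g)) \<and>
     (\<exists>A. \<forall>f\<in>V. \<forall>g\<in>V. \<bar>a f g\<bar> \<le> A * H1_norm \<Omega> f * H1_norm \<Omega> g) \<and>
     (\<exists>\<alpha>>0. \<forall>f\<in>V. \<alpha> * (H1_norm \<Omega> f)\<^sup>2 \<le> a f f) \<and>
     linear_form_on V l \<and>
     (\<exists>B. \<forall>f\<in>V. \<bar>l f\<bar> \<le> B * H1_norm \<Omega> f)"

definition exact_solution ::
    "('a \<Rightarrow> real) set \<Rightarrow> (('a \<Rightarrow> real) \<Rightarrow> ('a \<Rightarrow> real) \<Rightarrow> real) \<Rightarrow> (('a \<Rightarrow> real) \<Rightarrow> real)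
      \<Rightarrow> ('a \<Rightarrow> real) \<Rightarrow> bool" where
  "exact_solution V a l u \<longleftrightarrow> u \<in> V \<and> (\<forall>v\<in>V. a u v = l v)"

(* Diameter of the largest ball contained in K. *)
definition inball_diameter :: "'a::euclidean_space set \<Rightarrow> real" where
  "inball_diameter K = Sup {2 * r | x r. 0 \<le> r \<and> cball x r \<subseteq> K}"

(* Regularity in the sense of Ciarlet, with shape constant \<sigma>. The conformity condition (two
   simplexes meet in a common face) is part of triangulation. *)
definition regular_mesh ::
    "real \<Rightarrow> 'a::euclidean_space set \<Rightarrow> 'a set set \<Rightarrow> bool" where
  "regular_mesh \<sigma> \<Omega> \<T> \<longleftrightarrow>
     triangulation \<T> \<and> (\<forall>K\<in>\<T>. int DIM('a) simplex K) \<and> \<Union>\<T> = closure \<Omega> \<and>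
     (\<forall>K\<in>\<T>. diameter K \<le> \<sigma> * inball_diameter K)"

definition mesh_size :: "'a::euclidean_space set set \<Rightarrow> real" where
  "mesh_size \<T> = Max (diameter ` \<T>)"

(* Polynomial functions of total degree at most i, as combinations of monomials with
   multi-indices \<alpha>. *)
definition poly_deg_le :: "nat \<Rightarrow> ('a::euclidean_space \<Rightarrow> real) set" where
  "poly_deg_le i =
     {p. \<exists>c. \<forall>x. p x = (\<Sum>\<alpha> | \<alpha> \<in> Basis \<rightarrow>\<^sub>E {..i} \<and> sum \<alpha> Basis \<le> i.
                          c \<alpha> * (\<Prod>b\<in>Basis. (x \<bullet> b) ^ \<alpha> b))}"

(* Conforming P_i Lagrange space; essential boundary conditions are those encoded in V. *)
definition lagrange_space ::
    "'a::euclidean_space set \<Rightarrow> ('a \<Rightarrow> real) set \<Rightarrow> nat \<Rightarrow> 'a set set \<Rightarrow> ('a \<Rightarrow> real) set" where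
  "lagrange_space \<Omega> V i \<T> =
     {v \<in> V. continuous_on (closure \<Omega>) v \<and>
             (\<forall>K\<in>\<T>. \<exists>p\<in>poly_deg_le i. \<forall>x\<in>K. v x = p x)}"

definition lagrange_approximation ::
    "'a::euclidean_space set \<Rightarrow> ('a \<Rightarrow> real) set \<Rightarrow> (('a \<Rightarrow> real) \<Rightarrow> ('a \<Rightarrow> real) \<Rightarrow> real)
      \<Rightarrow> (('a \<Rightarrow> real) \<Rightarrow> real) \<Rightarrow> nat \<Rightarrow> 'a set set \<Rightarrow> ('a \<Rightarrow> real) \<Rightarrow> bool" where
  "lagrange_approximation \<Omega> V a l i \<T> w \<longleftrightarrow>
     w \<in> lagrange_space \<Omega> V i \<T> \<and> (\<forall>v\<in>lagrange_space \<Omega> V i \<T>. a w v = l v)"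

(* The error bound with one constant C for all meshes of the regular family. *)
definition error_estimate ::
    "real \<Rightarrow> 'a::euclidean_space set \<Rightarrow> ('a \<Rightarrow> real) set \<Rightarrow>
      (('a \<Rightarrow> real) \<Rightarrow> ('a \<Rightarrow> real) \<Rightarrow> real) \<Rightarrow> (('a \<Rightarrow> real) \<Rightarrow> real) \<Rightarrow> ('a \<Rightarrow> real)
      \<Rightarrow> nat \<Rightarrow> real \<Rightarrow> bool" where
  "error_estimate \<sigma> \<Omega> V a l u i C \<longleftrightarrow>
     (\<forall>\<T> w. regular_mesh \<sigma> \<Omega> \<T> \<and> lagrange_approximation \<Omega> V a l i \<T> w \<longrightarrow>
        H1_norm \<Omega> (\<lambda>x. w x - u x) \<le> C * mesh_size \<T> ^ i)"

(* Random P_i approximation: each outcome of the mesh generator yields a regular mesh of the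
   prescribed size h and the approximation w computed on it. The generator T is attached to the
   degree i: since the P_k space is contained in the P_m space, Cea's lemma bounds the P_m error
   by a multiple of the P_k error on the same mesh, so the two errors could not be independent
   and uniform if both degrees were forced to share one mesh outcome. *)
definition random_lagrange_approximation ::
    "'w measure \<Rightarrow> real \<Rightarrow> 'a::euclidean_space set \<Rightarrow> ('a \<Rightarrow> real) set \<Rightarrow>
      (('a \<Rightarrow> real) \<Rightarrow> ('a \<Rightarrow> real) \<Rightarrow> real) \<Rightarrow> (('a \<Rightarrow> real) \<Rightarrow> real)
      \<Rightarrow> nat \<Rightarrow> real \<Rightarrow> ('w \<Rightarrow> 'a set set) \<Rightarrow> ('w \<Rightarrow> 'a \<Rightarrow> real) \<Rightarrow> bool" where
  "random_lagrange_approximation M \<sigma> \<Omega> V a l i h T w \<longleftrightarrow>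
     (\<forall>\<omega>\<in>space M. regular_mesh \<sigma> \<Omega> (T \<omega>) \<and> mesh_size (T \<omega>) = h \<and>
                  lagrange_approximation \<Omega> V a l i (T \<omega>) (w \<omega>))"

definition uniform_on_interval :: "'w measure \<Rightarrow> ('w \<Rightarrow> real) \<Rightarrow> real \<Rightarrow> real \<Rightarrow> bool" where
  "uniform_on_interval M X s t \<longleftrightarrow>
     distributed M lborel X (\<lambda>x. indicator {s..t} x / measure lborel {s..t})"

end

theory Submission
  imports Defs
begin

text \<open>
  By independence, \<open>S\<close> vanishes with probability the product of the probabilities \<open>q n\<close> that
  \<open>X k n < X m n\<close>. If \<open>X\<close> and \<open>Y\<close> are independent and uniform on \<open>[0, a]\<close> and \<open>[0, b]\<close> with
  \<open>b \<le> a\<close>, conditioning on the variable \<open>Y\<close> with the shorter range gives the probability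
  \<open>b / (2 * a)\<close> for \<open>X < Y\<close>. The ratio of the range of \<open>X m n\<close> to that of \<open>X k n\<close> is
  \<open>(h n / hs) ^ (m - k)\<close>, so the sign of \<open>h n - hs\<close> decides which of the two is shorter; on a
  coarse mesh the formula is applied to the complementary event.
\<close>

lemma nn_integral_id_Icc:
  fixes b c :: real
  assumes "0 \<le> b" "0 \<le> c"
  shows "(\<integral>\<^sup>+y. ennreal (c * y) * indicator {0..b} y \<partial>lborel) = ennreal (c * b\<^sup>2 / 2)"
proof -
  have "(\<integral>\<^sup>+y. ennreal (c * y) * indicator {0..b} y \<partial>lborel)
      = ennreal (c * b\<^sup>2 / 2 - c * 0\<^sup>2 / 2)"
    using assms by (intro nn_integral_FTC_Icc) (auto intro!: derivative_eq_intros)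
  then show ?thesis by simp
qed

text \<open>The joint density is \<open>1 / (a * b)\<close> on the rectangle, and the section of the
  event at height \<open>y\<close> has length \<open>y\<close>, so the probability is the integral
  of \<open>y / (a * b)\<close> over \<open>{0..b}\<close>. Only the length of the sections enters;
  keeping \<open>R\<close> abstract lets the strict and the non-strict comparison share this
  computation.\<close>

lemma (in prob_space) prob_uniform_rel:
  fixes X Y :: "'a \<Rightarrow> real" and R :: "real \<Rightarrow> real \<Rightarrow> bool"
  assumes X: "uniform_on_interval M X 0 a" and Y: "uniform_on_interval M Y 0 b"
    and indep: "indep_var borel X borel Y"
    and b: "0 < b" "b \<le> a"
    and R_meas [measurable]: "Measurable.pred (borel \<Otimes>\<^sub>M borel) (\<lambda>p. R (fst p) (snd p))"
    and R_len: "\<And>y. y \<in> {0..b} \<Longrightarrow> emeasure lborel {x \<in> {0..a}. R x y} = ennreal y"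
  shows "prob {\<omega> \<in> space M. R (X \<omega>) (Y \<omega>)} = b / (2 * a)"
proof -
  have a: "0 < a" using b by linarith
  define f g :: "real \<Rightarrow> ennreal"
    where "f = (\<lambda>x. indicator {0..a} x / measure lborel {0..a})"
      and "g = (\<lambda>y. indicator {0..b} y / measure lborel {0..b})"
  have f_eq: "f x = ennreal (1 / a) * indicator {0..a} x"
    and g_eq: "g x = ennreal (1 / b) * indicator {0..b} x" for x
    using a b by (auto simp: f_def g_def indicator_def divide_ennreal simp flip: ennreal_1 ennreal_mult)
  have [measurable]: "f \<in> borel_measurable borel" "g \<in> borel_measurable borel"
    unfolding f_eq[abs_def] g_eq[abs_def] by measurable
  \<comment> \<open>The densities are taken with respect to \<open>lborel\<close>, so independence
    is restated over it; its sigma-algebra is the Borel one.\<close>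
  have "indep_var lborel X lborel Y"
    using indep by (simp add: indep_var_eq measurable_lborel1 cong: measurable_cong_sets)
  then have joint: "distributed M (lborel \<Otimes>\<^sub>M lborel) (\<lambda>\<omega>. (X \<omega>, Y \<omega>)) (\<lambda>(x, y). f x * g y)"
    using X Y unfolding uniform_on_interval_def f_def g_def
    by (intro distributed_joint_indep) (auto intro: lborel.sigma_finite_measure_axioms)
  define A where "A = {p \<in> space (borel \<Otimes>\<^sub>M borel). R (fst p) (snd p)}"
  have A_borel: "A \<in> sets (borel \<Otimes>\<^sub>M borel)"
    unfolding A_def by measurable
  then have A: "A \<in> sets (lborel \<Otimes>\<^sub>M lborel)"
    by (simp cong: sets_pair_measure_cong)
  have in_A: "(x, y) \<in> A \<longleftrightarrow> R x y" for x y
    by (simp add: A_def space_pair_measure)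
  \<comment> \<open>With \<open>y\<close> fixed the integrand is constant on the section of
    \<open>A\<close> inside \<open>{0..a}\<close>; this prepares Tonelli with \<open>y\<close> as
    the outer variable.\<close>
  have inner: "(\<integral>\<^sup>+x. (f x * g y) * indicator A (x, y) \<partial>lborel)
      = ennreal (1 / (a * b) * y) * indicator {0..b} y" for y
  proof (cases "y \<in> {0..b}")
    case True
    have R_sets: "{x \<in> {0..a}. R x y} \<in> sets lborel"
    proof -
      have "Measurable.pred borel (\<lambda>x. R (fst (x, y)) (snd (x, y)))"
        by (rule measurable_compose[OF _ R_meas]) simp
      then show ?thesis by simp
    qed
    have "(\<integral>\<^sup>+x. (f x * g y) * indicator A (x, y) \<partial>lborel)
        = (\<integral>\<^sup>+x. ennreal (1 / (a * b)) * indicator {x \<in> {0..a}. R x y} x \<partial>lborel)"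
      using True a b
      by (intro nn_integral_cong)
         (auto simp: f_eq g_eq in_A indicator_def simp flip: ennreal_mult)
    also have "\<dots> = ennreal (1 / (a * b)) * ennreal y"
      by (simp only: nn_integral_cmult_indicator[OF R_sets] R_len[OF True])
    finally show ?thesis
      using True a b by (simp flip: ennreal_mult)
  qed (simp add: g_eq)
  have "emeasure M {\<omega> \<in> space M. R (X \<omega>) (Y \<omega>)} = emeasure M ((\<lambda>\<omega>. (X \<omega>, Y \<omega>)) -` A \<inter> space M)"
    by (intro arg_cong[where f = "emeasure M"]) (auto simp: in_A)
  also have "\<dots> = (\<integral>\<^sup>+p. (case p of (x, y) \<Rightarrow> f x * g y) * indicator A p \<partial>(lborel \<Otimes>\<^sub>M lborel))"
    by (rule distributed_emeasure[OF joint A])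
  also have "\<dots> = (\<integral>\<^sup>+y. (\<integral>\<^sup>+x. (f x * g y) * indicator A (x, y) \<partial>lborel) \<partial>lborel)"
    using A by (subst lborel_pair.nn_integral_snd[symmetric]) (auto simp: split_beta)
  also have "\<dots> = ennreal (1 / (a * b) * b\<^sup>2 / 2)"
    unfolding inner using a b by (intro nn_integral_id_Icc) auto
  also have "1 / (a * b) * b\<^sup>2 / 2 = b / (2 * a)"
    using a b by (simp add: power2_eq_square)
  finally show ?thesis
    using a b by (simp add: emeasure_eq_measure)
qed

lemma (in prob_space) prob_uniform_le:
  fixes X Y :: "'a \<Rightarrow> real"
  assumes "uniform_on_interval M X 0 a" "uniform_on_interval M Y 0 b"
    and "indep_var borel X borel Y" "0 < b" "b \<le> a"
  shows "prob {\<omega> \<in> space M. X \<omega> \<le> Y \<omega>} = b / (2 * a)"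
proof (rule prob_uniform_rel[OF assms])
  fix y assume "y \<in> {0..b}"
  \<comment> \<open>Here \<open>b \<le> a\<close> matters: since \<open>y \<le> b \<le> a\<close>,
    the section is not cut off at \<open>a\<close>.\<close>
  then have "{x \<in> {0..a}. x \<le> y} = {0..y}" using assms by auto
  with \<open>y \<in> {0..b}\<close> show "emeasure lborel {x \<in> {0..a}. x \<le> y} = ennreal y" by simp
qed measurable

lemma (in prob_space) prob_uniform_less:
  fixes X Y :: "'a \<Rightarrow> real"
  assumes "uniform_on_interval M X 0 a" "uniform_on_interval M Y 0 b"
    and "indep_var borel X borel Y" "0 < b" "b \<le> a"
  shows "prob {\<omega> \<in> space M. X \<omega> < Y \<omega>} = b / (2 * a)"
proof (rule prob_uniform_rel[OF assms])
  fix y assume "y \<in> {0..b}"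
  then have "{x \<in> {0..a}. x < y} = {0..<y}" using assms by auto
  with \<open>y \<in> {0..b}\<close> show "emeasure lborel {x \<in> {0..a}. x < y} = ennreal y" by simp
qed measurable

text \<open>On coarse meshes the two errors exchange their roles as the variable with the longer and
  the one with the shorter range.\<close>

lemma (in prob_space) indep_var_commute:
  assumes "indep_var S X T Y"
  shows "indep_var T Y S X"
  using assms unfolding indep_var_eq indep_sets2_eq
  by (simp add: Ball_def) (subst Int_commute, simp add: mult.commute)

text \<open>A sum of naturals vanishes iff every term does, so the complementary event is an
  intersection of independent events.\<close>

lemma (in prob_space) prob_indep_sum_ge_1:
  fixes Y :: "'i \<Rightarrow> 'a \<Rightarrow> nat"
  assumes fin: "finite I"
    and indep: "indep_vars (\<lambda>_. count_space UNIV) Y I"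
  shows "prob {\<omega> \<in> space M. (\<Sum>i\<in>I. Y i \<omega>) \<ge> 1}
       = 1 - (\<Prod>i\<in>I. prob {\<omega> \<in> space M. Y i \<omega> = 0})"
proof -
  have [measurable]: "Y i \<in> measurable M (count_space UNIV)" if "i \<in> I" for i
    using indep that by (auto simp: indep_vars_def)
  have sum_meas: "(\<lambda>\<omega>. \<Sum>i\<in>I. Y i \<omega>) \<in> measurable M (count_space UNIV)"
    by measurable
  have "prob {\<omega> \<in> space M. (\<Sum>i\<in>I. Y i \<omega>) \<ge> 1} = 1 - prob {\<omega> \<in> space M. \<not> (\<Sum>i\<in>I. Y i \<omega>) \<ge> 1}"
    using sum_meas by (subst prob_neg[symmetric]) auto
  also have "{\<omega> \<in> space M. \<not> (\<Sum>i\<in>I. Y i \<omega>) \<ge> 1} = {\<omega> \<in> space M. \<forall>i\<in>I. Y i \<omega> = 0}"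
    using fin by (auto simp: not_le)
  also have "prob \<dots> = (\<Prod>i\<in>I. prob {\<omega> \<in> space M. Y i \<omega> = 0})"
  \<comment> \<open>The product rule for independent variables asks for a nonempty index set; for
    empty \<open>I\<close> both sides are 1.\<close>
  proof (cases "I = {}")
    case False
    have "prob (\<Inter>i\<in>I. Y i -` {0} \<inter> space M) = (\<Prod>i\<in>I. prob (Y i -` {0} \<inter> space M))"
      by (rule indep_varsD_finite[OF indep False fin]) simp
    moreover have "(\<Inter>i\<in>I. Y i -` {0} \<inter> space M) = {\<omega> \<in> space M. \<forall>i\<in>I. Y i \<omega> = 0}"
      using False by auto
    moreover have "Y i -` {0} \<inter> space M = {\<omega> \<in> space M. Y i \<omega> = 0}" for i
      by auto
    ultimately show ?thesis by simp
  qed (simp add: prob_space)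
  finally show ?thesis .
qed

theorem proposition3p3:
  fixes \<Omega> :: "'a::euclidean_space set"
    and V :: "('a \<Rightarrow> real) set"
    and a :: "('a \<Rightarrow> real) \<Rightarrow> ('a \<Rightarrow> real) \<Rightarrow> real"
    and l :: "('a \<Rightarrow> real) \<Rightarrow> real"
    and u :: "'a \<Rightarrow> real"
    and k m N N1 N2 :: nat
    and \<sigma> hs :: real
    and C :: "nat \<Rightarrow> real"
    and h :: "nat \<Rightarrow> real"
    and M :: "'w measure"
    and T :: "nat \<Rightarrow> nat \<Rightarrow> 'w \<Rightarrow> 'a set set"
    and uh :: "nat \<Rightarrow> nat \<Rightarrow> 'w \<Rightarrow> 'a \<Rightarrow> real"
    and X :: "nat \<Rightarrow> nat \<Rightarrow> 'w \<Rightarrow> real"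
    and Y :: "nat \<Rightarrow> 'w \<Rightarrow> nat"
    and S :: "'w \<Rightarrow> nat"
  assumes km: "0 < k" "k < m"
    and problem: "elliptic_problem \<Omega> V a l"
    and solution: "exact_solution V a l u"
    and regularity: "u \<in> sobolev \<Omega> (m + 1)"
    and C_pos: "\<And>i. i \<in> {k, m} \<Longrightarrow> C i > 0"
    and estimate: "\<And>i. i \<in> {k, m} \<Longrightarrow> error_estimate \<sigma> \<Omega> V a l u i (C i)"
    and prob: "prob_space M"
    and h_pos: "\<And>n. n \<in> {1..N} \<Longrightarrow> h n > 0"
    and approximation: "\<And>i n. i \<in> {k, m} \<Longrightarrow> n \<in> {1..N} \<Longrightarrow>
           random_lagrange_approximation M \<sigma> \<Omega> V a l i (h n) (T i n) (uh i n)"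
    and X_eq: "\<And>i n \<omega>. X i n \<omega> = H1_norm \<Omega> (\<lambda>x. uh i n \<omega> x - u x)"
    and X_uniform: "\<And>i n. i \<in> {k, m} \<Longrightarrow> n \<in> {1..N} \<Longrightarrow>
           uniform_on_interval M (X i n) 0 (C i * h n ^ i)"
    and X_indep: "\<And>n. n \<in> {1..N} \<Longrightarrow>
           prob_space.indep_var M borel (X k n) borel (X m n)"
    and hs_eq: "hs = (C k / C m) powr (1 / real (m - k))"
    and N_eq: "N = N1 + N2"
    and fine: "\<And>n. n \<in> {1..N1} \<Longrightarrow> h n \<le> hs"
    and coarse: "\<And>n. n \<in> {N1 + 1..N} \<Longrightarrow> h n > hs"
    and Y_eq: "\<And>n \<omega>. Y n \<omega> = (if X m n \<omega> \<le> X k n \<omega> then 1 else 0)"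
    and Y_indep: "prob_space.indep_vars M (\<lambda>_. count_space UNIV) Y {1..N}"
    and S_eq: "\<And>\<omega>. S \<omega> = (\<Sum>n = 1..N. Y n \<omega>)"
  shows "measure M {\<omega> \<in> space M. S \<omega> \<ge> 1} =
           1 - 1 / 2 ^ N1 * ((\<Prod>n = 1..N1. h n) / hs ^ N1) ^ (m - k)
                 * (\<Prod>n = N1 + 1..N. 1 - 1 / 2 * (hs / h n) ^ (m - k))"
proof -
  interpret prob_space M by (rule prob)
  have Ck: "0 < C k" and Cm: "0 < C m" using C_pos by auto
  have hs: "0 < hs" using Ck Cm by (simp add: hs_eq)
  have hs_pow: "hs ^ (m - k) = C k / C m"
    using Ck Cm km hs by (simp add: hs_eq powr_powr flip: powr_realpow)
  \<comment> \<open>By \<open>hs_pow\<close>, \<open>hs\<close> is the mesh size at which the two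
    error bounds coincide; elsewhere their ratio is a power of \<open>x / hs\<close>.\<close>
  have scale: "C m * x ^ m = C k * x ^ k * (x / hs) ^ (m - k)" if "0 < x" for x
  proof -
    have "C k * x ^ k * (x / hs) ^ (m - k) = C m * (x ^ k * x ^ (m - k))"
      using Ck Cm by (simp add: power_divide hs_pow)
    then show ?thesis using km by (simp flip: power_add)
  qed
  define q where "q n = prob {\<omega> \<in> space M. Y n \<omega> = 0}" for n
  have q_eq: "q n = prob {\<omega> \<in> space M. X k n \<omega> < X m n \<omega>}" for n
  proof -
    have "Y n \<omega> = 0 \<longleftrightarrow> X k n \<omega> < X m n \<omega>" for \<omega>
      by (simp add: Y_eq not_le)
    then show ?thesis by (simp only: q_def)
  qed
  have q_fine: "q n = 1 / 2 * (h n / hs) ^ (m - k)" if n: "n \<in> {1..N1}" for n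
  proof -
    have nN: "n \<in> {1..N}" using n N_eq by auto
    have hn: "0 < h n" using h_pos nN .
    have "(h n / hs) ^ (m - k) \<le> 1"
      using hn hs fine[OF n] by (intro power_le_one) auto
    then have "C m * h n ^ m \<le> C k * h n ^ k"
      using Ck hn by (simp add: scale mult_le_cancel_left1)
    moreover have "0 < C m * h n ^ m" using Cm hn by simp
    \<comment> \<open>The degree \<open>m\<close> error has the shorter range, so it is the second
      variable, and the strict version applies directly.\<close>
    ultimately have "q n = C m * h n ^ m / (2 * (C k * h n ^ k))"
      unfolding q_eq using X_uniform nN X_indep[OF nN] by (intro prob_uniform_less) auto
    then show ?thesis using Ck hn by (simp add: scale)
  qed
  have q_coarse: "q n = 1 - 1 / 2 * (hs / h n) ^ (m - k)" if n: "n \<in> {N1 + 1..N}" for n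
  proof -
    have nN: "n \<in> {1..N}" using n by auto
    have hn: "0 < h n" using h_pos nN .
    have "1 \<le> (h n / hs) ^ (m - k)"
      using hn hs coarse[OF n] by (intro one_le_power) auto
    moreover have pos: "0 < C k * h n ^ k" using Ck hn by simp
    ultimately have le: "C k * h n ^ k \<le> C m * h n ^ m"
      using mult_left_mono[of 1 "(h n / hs) ^ (m - k)" "C k * h n ^ k"] scale[OF hn] by simp
    have [measurable]: "X k n \<in> borel_measurable M" "X m n \<in> borel_measurable M"
      using X_indep[OF nN] by (auto simp: indep_var_eq)
    have "{\<omega> \<in> space M. X k n \<omega> < X m n \<omega>} \<in> events" by measurable
    then have "q n = 1 - prob {\<omega> \<in> space M. \<not> X k n \<omega> < X m n \<omega>}"
      using prob_neg[of "\<lambda>\<omega>. X k n \<omega> < X m n \<omega>"] by (simp add: q_eq)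
    \<comment> \<open>Now \<open>X k n\<close> has the shorter range. The complement of a strict
      comparison is the reversed non-strict one, which puts \<open>X k n\<close> second.\<close>
    also have "prob {\<omega> \<in> space M. \<not> X k n \<omega> < X m n \<omega>} = C k * h n ^ k / (2 * (C m * h n ^ m))"
      unfolding not_less
      using X_uniform nN indep_var_commute[OF X_indep[OF nN]] le pos
      by (intro prob_uniform_le) auto
    also have "\<dots> = 1 / 2 * (hs / h n) ^ (m - k)"
      using Ck hn hs by (simp add: scale power_divide)
    finally show ?thesis .
  qed
  \<comment> \<open>Splitting at \<open>N1\<close> separates fine from coarse meshes; either factor
    may be an empty product.\<close>
  have "(\<Prod>n = 1..N. q n) = (\<Prod>n = 1..N1. q n) * (\<Prod>n = N1 + 1..N. q n)"
    unfolding N_eq by (rule prod.ub_add_nat) simp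
  also have "(\<Prod>n = 1..N1. q n) = 1 / 2 ^ N1 * ((\<Prod>n = 1..N1. h n) / hs ^ N1) ^ (m - k)"
    by (simp add: q_fine prod.distrib prod_dividef prod_power_distrib power_divide power_one_over
        mult.commute flip: power_mult)
  also have "(\<Prod>n = N1 + 1..N. q n) = (\<Prod>n = N1 + 1..N. 1 - 1 / 2 * (hs / h n) ^ (m - k))"
    by (intro prod.cong refl q_coarse)
  finally show ?thesis
    unfolding S_eq prob_indep_sum_ge_1[OF finite_atLeastAtMost Y_indep] q_def by simp
qed

end
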